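(* Let $D$ be the formal derivative with respect to the grammar $$\{x_1y_1\rightarrow 2tx_1y_1(x_2+y_2),\ x_2\rightarrow 2tx_1y_1,\ y_2\rightarrow 2tx_1y_1,\ t\rightarrow t^2(x_2+y_2)\},$$ i.e. the unique $\mathbb Q$-linear derivation of $\mathbb Q[w,x_2,y_2,t]$, where $w$ stands for the product $x_1y_1$ treated as a single variable, with $D(w)=2tw(x_2+y_2)$, $D(x_2)=2tw$, $D(y_2)=2tw$, $D(t)=t^2(x_2+y_2)$. Then for every $n\ge0$, $$D^n(y_2)=(n+1)!\,t^n\,G_n(x_1,x_2;y_1,y_2)$$ (with $w=x_1y_1$ substituted).
   Context: A formal derivative with respect to a grammar (a set of substitution rules $z\to f_z$ for variables $z$) is the linear operator $D$ satisfying $D(z)=f_z$, $D(uv)=D(u)v+uD(v)$, $D(u+v)=D(u)+D(v)$ and $D(c)=0$ for constants. A plane tree is an unlabeled rooted tree in which the children of every vertex are linearly ordered; $\mathcal P_n$ is the set of plane trees with $n$ edges. A leaf is a vertex with no children, an interior vertex one with at least one child. A leaf is old if it is the leftmost child of its parent (including an only child), young otherwise. For $T\in\mathcal P_n$, $\mathrm{oleaf},\mathrm{yleaf}$ count old and young leaves, $\mathrm{oint}$ counts interior vertices that are parents of old leaves, $\mathrm{yint}$ counts the other interior vertices. For $n\ge1$, $G_n(x_1,x_2;y_1,y_2)=\sum_{T\in\mathcal P_n}x_1^{\mathrm{oleaf}(T)}x_2^{\mathrm{yleaf}(T)}y_1^{\mathrm{oint}(T)}y_2^{\mathrm{yint}(T)}$,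 and $G_0=y_2$. *)

theory Defs
  imports Complex_Main "HOL-Library.Poly_Mapping"
begin

section \<open>Polynomials with rational coefficients\<close>

text \<open>The type \<open>'v qpoly\<close> is the polynomial ring over the rationals with one variable for each
  element of \<open>'v\<close>: a polynomial maps monomials (exponent vectors of finite support) to
  coefficients. The ring structure is the convolution product of Poly_Mapping.\<close>

type_synonym 'v qpoly = "('v \<Rightarrow>\<^sub>0 nat) \<Rightarrow>\<^sub>0 rat"

definition Var :: "'v \<Rightarrow> 'v qpoly" where
  "Var v = Poly_Mapping.single (Poly_Mapping.single v 1) 1"

definition Const :: "rat \<Rightarrow> 'v qpoly" where
  "Const c = Poly_Mapping.single 0 c"

definition poly_subst :: "('v \<Rightarrow> 'u qpoly) \<Rightarrow> 'v qpoly \<Rightarrow> 'u qpoly" where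
  "poly_subst \<sigma> p = (\<Sum>m\<in>Poly_Mapping.keys p. Const (Poly_Mapping.lookup p m) *
     (\<Prod>v\<in>Poly_Mapping.keys m. \<sigma> v ^ Poly_Mapping.lookup m v))"

section \<open>Formal derivatives with respect to a grammar\<close>

definition is_formal_derivative :: "('v \<Rightarrow> 'v qpoly) \<Rightarrow> ('v qpoly \<Rightarrow> 'v qpoly) \<Rightarrow> bool" where
  "is_formal_derivative f D \<longleftrightarrow>
     (\<forall>z. D (Var z) = f z) \<and>
     (\<forall>u v. D (u * v) = D u * v + u * D v) \<and>
     (\<forall>u v. D (u + v) = D u + D v) \<and>
     (\<forall>c. D (Const c) = 0)"

definition formal_derivative :: "('v \<Rightarrow> 'v qpoly) \<Rightarrow> 'v qpoly \<Rightarrow> 'v qpoly" where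
  "formal_derivative f = (THE D. is_formal_derivative f D)"

text \<open>The description is proper: every grammar has exactly one formal derivative.\<close>

lemma single_Var_power:
  "Poly_Mapping.single (Poly_Mapping.single v k) 1 = Var v ^ k"
proof (induction k)
  case (Suc k)
  have "Poly_Mapping.single v (Suc k) = Poly_Mapping.single v 1 + Poly_Mapping.single v k"
    by (simp flip: single_add)
  then show ?case
    by (simp add: Suc[symmetric]) (simp add: Var_def mult_single)
qed simp

lemma update_eq_add_single:
  fixes f :: "'a \<Rightarrow>\<^sub>0 'b::comm_monoid_add"
  assumes "a \<notin> Poly_Mapping.keys f"
  shows "Poly_Mapping.update a b f = f + Poly_Mapping.single a b"
  using assms
  by (intro poly_mapping_eqI)
     (auto simp: lookup_update lookup_add lookup_single in_keys_iff when_def)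

lemma qpoly_induct [case_names Const Var add mult]:
  fixes p :: "'v qpoly"
  assumes C: "\<And>c. P (Const c)" and V: "\<And>v. P (Var v)"
    and A: "\<And>p q. P p \<Longrightarrow> P q \<Longrightarrow> P (p + q)" and M: "\<And>p q. P p \<Longrightarrow> P q \<Longrightarrow> P (p * q)"
  shows "P p"
proof -
  have one: "P 1" using C[of 1] by (simp add: Const_def)
  have pow: "P (Var v ^ k)" for v k
    by (induction k) (auto simp: one V M)
  have mono: "P (Poly_Mapping.single m 1)" for m :: "'v \<Rightarrow>\<^sub>0 nat"
  proof (induction m rule: update_induct)
    case const
    then show ?case using one by simp
  next
    case (update f a b)
    have "Poly_Mapping.single (Poly_Mapping.update a b f) (1::rat) =
        Poly_Mapping.single f 1 * Var a ^ b"
      by (simp add: update update_eq_add_single mult_single flip: single_Var_power)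
    then show ?case using M[OF update(3) pow] by simp
  qed
  show ?thesis
  proof (induction p rule: update_induct)
    case const
    then show ?case using C[of 0] by (simp add: Const_def)
  next
    case (update f a b)
    have "Poly_Mapping.update a b f = f + Const b * Poly_Mapping.single a 1"
      by (simp add: update update_eq_add_single mult_single Const_def)
    then show ?case using A[OF update(3) M[OF C mono]] by simp
  qed
qed

definition deriv_monom :: "('v \<Rightarrow> 'v qpoly) \<Rightarrow> ('v \<Rightarrow>\<^sub>0 nat) \<Rightarrow> 'v qpoly" where
  "deriv_monom f m = (\<Sum>v\<in>Poly_Mapping.keys m. of_nat (Poly_Mapping.lookup m v) * f v *
     Poly_Mapping.single (m - Poly_Mapping.single v 1) 1)"

definition deriv_poly :: "('v \<Rightarrow> 'v qpoly) \<Rightarrow> 'v qpoly \<Rightarrow> 'v qpoly" where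
  "deriv_poly f p =
     (\<Sum>m\<in>Poly_Mapping.keys p. Const (Poly_Mapping.lookup p m) * deriv_monom f m)"

lemma deriv_monom_superset:
  assumes "finite A" "Poly_Mapping.keys m \<subseteq> A"
  shows "deriv_monom f m = (\<Sum>v\<in>A. of_nat (Poly_Mapping.lookup m v) * f v *
     Poly_Mapping.single (m - Poly_Mapping.single v 1) 1)"
  unfolding deriv_monom_def using assms
  by (intro sum.mono_neutral_left) (auto simp: in_keys_iff)

lemma deriv_monom_add:
  "deriv_monom f (m + m') =
     deriv_monom f m * Poly_Mapping.single m' 1 + Poly_Mapping.single m 1 * deriv_monom f m'"
proof -
  let ?A = "Poly_Mapping.keys m \<union> Poly_Mapping.keys m'"
  let ?x = "\<lambda>m. Poly_Mapping.single m (1::rat)"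
  have sub: "of_nat (Poly_Mapping.lookup m v) * f v * ?x (m - Poly_Mapping.single v 1) * ?x m' =
      of_nat (Poly_Mapping.lookup m v) * f v * ?x (m + m' - Poly_Mapping.single v 1)" for m m' v
  proof (cases "Poly_Mapping.lookup m v = 0")
    case False
    then have "m - Poly_Mapping.single v 1 + m' = m + m' - Poly_Mapping.single v 1"
      by (intro poly_mapping_eqI)
         (auto simp: lookup_add lookup_minus lookup_single when_def)
    then show ?thesis by (simp add: mult_single mult.assoc)
  qed simp
  have "deriv_monom f m * ?x m' + ?x m * deriv_monom f m' =
      deriv_monom f m * ?x m' + deriv_monom f m' * ?x m"
    by (simp add: mult.commute)
  also have "\<dots> = (\<Sum>v\<in>?A. of_nat (Poly_Mapping.lookup m v) * f v *
        ?x (m + m' - Poly_Mapping.single v 1)) +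
      (\<Sum>v\<in>?A. of_nat (Poly_Mapping.lookup m' v) * f v * ?x (m' + m - Poly_Mapping.single v 1))"
    by (simp only: sub sum_distrib_right deriv_monom_superset[of ?A m] finite_UnI finite_keys
        deriv_monom_superset[of ?A m'] Un_upper1 Un_upper2)
  also have "\<dots> = (\<Sum>v\<in>?A. of_nat (Poly_Mapping.lookup (m + m') v) * f v *
        ?x (m + m' - Poly_Mapping.single v 1))"
    by (simp add: lookup_add algebra_simps flip: sum.distrib)
  also have "\<dots> = deriv_monom f (m + m')"
    by (rule deriv_monom_superset[symmetric]) (auto simp: keys_add)
  finally show ?thesis by simp
qed

lemma Const_add: "Const (a + b) = Const a + Const b"
  by (simp add: Const_def single_add)

lemma deriv_poly_add: "deriv_poly f (p + q) = deriv_poly f p + deriv_poly f q"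
  unfolding deriv_poly_def
  by (rule setsum_keys_plus_distrib) (simp_all add: Const_add algebra_simps, simp add: Const_def)

lemma deriv_poly_single: "deriv_poly f (Poly_Mapping.single m c) = Const c * deriv_monom f m"
  by (simp add: deriv_poly_def Const_def)

lemma poly_induct_single [case_names zero add]:
  fixes p :: "'a \<Rightarrow>\<^sub>0 'b::comm_monoid_add"
  assumes "P 0" and A: "\<And>p m c. P p \<Longrightarrow> P (p + Poly_Mapping.single m c)"
  shows "P p"
  by (induction p rule: update_induct) (simp_all add: assms update_eq_add_single)

lemma deriv_poly_mult: "deriv_poly f (p * q) = deriv_poly f p * q + p * deriv_poly f q"
proof (induction p rule: poly_induct_single)
  case zero
  then show ?case by (simp add: deriv_poly_def)
next
  case (add p m c)
  have "deriv_poly f (Poly_Mapping.single m c * q) =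
      deriv_poly f (Poly_Mapping.single m c) * q + Poly_Mapping.single m c * deriv_poly f q"
  proof (induction q rule: poly_induct_single)
    case zero
    then show ?case by (simp add: deriv_poly_def)
  next
    case (add q n d)
    have s: "Poly_Mapping.single k a = Const a * Poly_Mapping.single k 1" for k a
      by (simp add: Const_def mult_single)
    have c: "Const (c * d) = Const c * Const d"
      by (simp add: Const_def mult_single)
    have "deriv_poly f (Poly_Mapping.single m c * Poly_Mapping.single n d) =
        deriv_poly f (Poly_Mapping.single m c) * Poly_Mapping.single n d +
        Poly_Mapping.single m c * deriv_poly f (Poly_Mapping.single n d)"
      unfolding mult_single deriv_poly_single deriv_monom_add
      unfolding s[of m c] s[of n d] c by (simp add: algebra_simps)
    then show ?case using add by (simp add: algebra_simps deriv_poly_add)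
  qed
  then show ?case using add by (simp add: algebra_simps deriv_poly_add)
qed

theorem formal_derivative_ex1: "\<exists>!D. is_formal_derivative f D"
proof (rule ex1I)
  have "deriv_poly f (Var z) = f z" for z
    by (simp add: Var_def deriv_poly_single deriv_monom_def) (simp add: Const_def)
  moreover have "deriv_poly f (Const c) = 0" for c
    by (simp add: Const_def deriv_poly_single deriv_monom_def)
  ultimately show "is_formal_derivative f (deriv_poly f)"
    by (simp add: is_formal_derivative_def deriv_poly_add deriv_poly_mult)
next
  fix D assume D: "is_formal_derivative f D"
  have "D p = deriv_poly f p" for p
  proof (induction p rule: qpoly_induct)
    case (Const c)
    then show ?case using D
      by (simp add: is_formal_derivative_def Const_def deriv_poly_single deriv_monom_def)
  next
    case (Var v)
    have "deriv_poly f (Var v) = f v"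
      by (simp add: Var_def deriv_poly_single deriv_monom_def) (simp add: Const_def)
    then show ?case using D by (simp add: is_formal_derivative_def)
  next
    case (add p q)
    then show ?case using D by (simp add: is_formal_derivative_def deriv_poly_add)
  next
    case (mult p q)
    then show ?case using D by (simp add: is_formal_derivative_def deriv_poly_mult)
  qed
  then show "D = deriv_poly f" by auto
qed

lemma is_formal_derivative_formal_derivative: "is_formal_derivative f (formal_derivative f)"
  unfolding formal_derivative_def by (rule theI'[OF formal_derivative_ex1])

section \<open>Plane trees\<close>

datatype plane_tree = Node "plane_tree list"

text \<open>A vertex is addressed by the list of child indices (counted from the left, starting with
  \<open>0\<close>) on the path from the root to it; so the root is \<open>[]\<close> and the children of \<open>p\<close>
  are the vertices of the form \<open>p @ [i]\<close>.\<close>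

function vertices :: "plane_tree \<Rightarrow> nat list set" where
  "vertices (Node ts) = insert [] (\<Union>i\<in>{..<length ts}. (#) i ` vertices (ts ! i))"
  by pat_completeness auto
termination
  by (relation "measure size") (auto simp: less_Suc_eq_le intro: size_list_estimation'[OF nth_mem])

definition children :: "plane_tree \<Rightarrow> nat list \<Rightarrow> nat list set" where
  "children T p = {p @ [i] | i. p @ [i] \<in> vertices T}"

definition edges :: "plane_tree \<Rightarrow> (nat list \<times> nat list) set" where
  "edges T = {(p, q). p \<in> vertices T \<and> q \<in> children T p}"

definition plane_trees :: "nat \<Rightarrow> plane_tree set" where
  "plane_trees n = {T. card (edges T) = n}"

definition leaf :: "plane_tree \<Rightarrow> nat list \<Rightarrow> bool" where
  "leaf T p \<longleftrightarrow> p \<in> vertices T \<and> children T p = {}"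

definition interior_vertex :: "plane_tree \<Rightarrow> nat list \<Rightarrow> bool" where
  "interior_vertex T p \<longleftrightarrow> p \<in> vertices T \<and> children T p \<noteq> {}"

definition old_leaf :: "plane_tree \<Rightarrow> nat list \<Rightarrow> bool" where
  "old_leaf T p \<longleftrightarrow> leaf T p \<and> (\<exists>q. p = q @ [0])"

definition young_leaf :: "plane_tree \<Rightarrow> nat list \<Rightarrow> bool" where
  "young_leaf T p \<longleftrightarrow> leaf T p \<and> \<not> old_leaf T p"

definition old_interior_vertex :: "plane_tree \<Rightarrow> nat list \<Rightarrow> bool" where
  "old_interior_vertex T p \<longleftrightarrow> interior_vertex T p \<and> (\<exists>q\<in>children T p. old_leaf T q)"

definition young_interior_vertex :: "plane_tree \<Rightarrow> nat list \<Rightarrow> bool" where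
  "young_interior_vertex T p \<longleftrightarrow> interior_vertex T p \<and> \<not> old_interior_vertex T p"

definition oleaf :: "plane_tree \<Rightarrow> nat" where
  "oleaf T = card {p. old_leaf T p}"

definition yleaf :: "plane_tree \<Rightarrow> nat" where
  "yleaf T = card {p. young_leaf T p}"

definition oint :: "plane_tree \<Rightarrow> nat" where
  "oint T = card {p. old_interior_vertex T p}"

definition yint :: "plane_tree \<Rightarrow> nat" where
  "yint T = card {p. young_interior_vertex T p}"

text \<open>The cardinalities above and the sum below range over finite sets.\<close>

lemma finite_vertices: "finite (vertices T)"
  by (induction T rule: vertices.induct) simp

lemma Cons_in_vertices:
  "i # p \<in> vertices (Node ts) \<longleftrightarrow> i < length ts \<and> p \<in> vertices (ts ! i)"
  by auto

lemma Nil_in_vertices: "[] \<in> vertices T"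
  by (cases T) simp

lemma vertices_butlast: "p @ [i] \<in> vertices T \<Longrightarrow> p \<in> vertices T"
proof (induction p arbitrary: T)
  case (Cons j p)
  then show ?case by (cases T) (auto simp: Cons_in_vertices simp del: vertices.simps)
qed (simp add: Nil_in_vertices)

lemma card_edges: "Suc (card (edges T)) = card (vertices T)"
proof -
  have "q \<in> snd ` edges T" if q: "q \<in> vertices T" "q \<noteq> []" for q
  proof -
    obtain p i where pi: "q = p @ [i]" using q(2) by (metis rev_exhaust)
    then have "(p, q) \<in> edges T"
      using q vertices_butlast by (auto simp: edges_def children_def)
    then show ?thesis by force
  qed
  then have "snd ` edges T = vertices T - {[]}"
    by (auto simp: edges_def children_def)
  moreover have "inj_on snd (edges T)"
    by (auto simp: inj_on_def edges_def children_def)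
  ultimately have "bij_betw snd (edges T) (vertices T - {[]})"
    by (simp add: bij_betw_def)
  then have "card (edges T) = card (vertices T - {[]})"
    by (rule bij_betw_same_card)
  then show ?thesis
    using card_Suc_Diff1[OF finite_vertices Nil_in_vertices] by metis
qed

lemma finite_plane_trees: "finite (plane_trees n)"
proof -
  have "finite {T. card (vertices T) \<le> k}" for k
  proof (induction k)
    case 0
    have "card (vertices T) \<noteq> 0" for T
      using finite_vertices Nil_in_vertices by auto
    then have "{T. card (vertices T) \<le> 0} = {}" by blast
    then show ?case by (simp only: finite.emptyI)
  next
    case (Suc k)
    let ?A = "{T. card (vertices T) \<le> k}"
    have "{T. card (vertices T) \<le> Suc k} \<subseteq> Node ` {ts. set ts \<subseteq> ?A \<and> length ts \<le> k}"
    proof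
      fix T assume T: "T \<in> {T. card (vertices T) \<le> Suc k}"
      obtain ts where ts: "T = Node ts" by (cases T)
      let ?V = "\<Union>i\<in>{..<length ts}. (#) i ` vertices (ts ! i)"
      have fin: "finite ?V"
        by (simp add: finite_vertices)
      have "[] \<notin> ?V" by auto
      then have "card (vertices T) = Suc (card ?V)"
        unfolding ts vertices.simps by (rule card_insert_disjoint[OF fin])
      then have V: "card ?V \<le> k" using T by simp
      have "ts ! i \<in> ?A" if "i < length ts" for i
      proof -
        have "card (vertices (ts ! i)) = card ((#) i ` vertices (ts ! i))"
          by (simp add: card_image)
        also have "\<dots> \<le> card ?V" using that by (intro card_mono fin) auto
        finally show ?thesis using V by simp
      qed
      moreover have "length ts \<le> k"
      proof -
        have "length ts = card ((\<lambda>i. [i]) ` {..<length ts})"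
          by (simp add: card_image inj_on_def)
        also have "\<dots> \<le> card ?V" using Nil_in_vertices by (intro card_mono fin) auto
        finally show ?thesis using V by simp
      qed
      ultimately show "T \<in> Node ` {ts. set ts \<subseteq> ?A \<and> length ts \<le> k}"
        by (auto simp: ts set_conv_nth)
    qed
    then show ?case
      by (rule finite_subset) (intro finite_imageI finite_lists_length_le Suc)
  qed
  from this[of "Suc n"] show ?thesis
    by (rule rev_finite_subset) (auto simp: plane_trees_def simp flip: card_edges)
qed

definition G :: "nat \<Rightarrow> 'a::comm_semiring_1 \<Rightarrow> 'a \<Rightarrow> 'a \<Rightarrow> 'a \<Rightarrow> 'a" where
  "G n x1 x2 y1 y2 =
     (if n = 0 then y2
      else \<Sum>T\<in>plane_trees n. x1 ^ oleaf T * x2 ^ yleaf T * y1 ^ oint T * y2 ^ yint T)"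

section \<open>The grammar\<close>

text \<open>\<open>GW\<close> is the single variable that stands for the product of $x_1$ and $y_1$.\<close>

datatype grammar_var = GW | GX2 | GY2 | GT

fun grammar :: "grammar_var \<Rightarrow> grammar_var qpoly" where
  "grammar GW = 2 * Var GT * Var GW * (Var GX2 + Var GY2)"
| "grammar GX2 = 2 * Var GT * Var GW"
| "grammar GY2 = 2 * Var GT * Var GW"
| "grammar GT = Var GT ^ 2 * (Var GX2 + Var GY2)"

datatype full_var = FX1 | FX2 | FY1 | FY2 | FT

fun w_subst :: "grammar_var \<Rightarrow> full_var qpoly" where
  "w_subst GW = Var FX1 * Var FY1"
| "w_subst GX2 = Var FX2"
| "w_subst GY2 = Var FY2"
| "w_subst GT = Var FT"

end

theory Submission
  imports Defs "HOL-Computational_Algebra.Formal_Power_Series"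
begin

text \<open>Put \<open>u = x\<^sub>2 + y\<^sub>2\<close> and \<open>w = x\<^sub>1 y\<^sub>1\<close>. Removing the last child of the root shows that
  \<open>P = (\<Sum>n\<ge>1. G\<^sub>n z\<^sup>n)\<close> satisfies \<open>P = z (w + u P + P\<^sup>2)\<close>. Differentiating this equation once
  with respect to \<open>z\<close> and once coefficientwise with \<open>D\<close> gives two linear equations with the same
  factor \<open>1 - z u - 2 z P\<close>, which is not a zero divisor. Comparing them yields
  \<open>D G\<^sub>n = t ((n + 2) G\<^sub>n\<^sub>+\<^sub>1 - n u G\<^sub>n)\<close> for \<open>n \<ge> 1\<close>, which is exactly the induction step.\<close>

section \<open>Statistics of a tree and its last principal subtree\<close>

lemma in_children_iff: "q \<in> children T p \<longleftrightarrow> (\<exists>i. q = p @ [i] \<and> q \<in> vertices T)"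
  by (auto simp: children_def)

lemma children_Cons:
  "i < length ts \<Longrightarrow> children (Node ts) (i # p) = (#) i ` children (ts ! i) p"
  by (auto simp: children_def Cons_in_vertices simp del: vertices.simps)

lemma children_Nil: "children (Node ts) [] = (\<lambda>i. [i]) ` {..<length ts}"
  by (auto simp: children_def Cons_in_vertices Nil_in_vertices simp del: vertices.simps)

lemma leaf_Cons: "leaf (Node ts) (i # p) \<longleftrightarrow> i < length ts \<and> leaf (ts ! i) p"
  by (auto simp: leaf_def children_Cons Cons_in_vertices simp del: vertices.simps)

lemma leaf_Nil: "leaf T [] \<longleftrightarrow> T = Node []"
  by (cases T) (auto simp: leaf_def children_Nil Nil_in_vertices simp del: vertices.simps)

lemma interior_vertex_Cons:
  "interior_vertex (Node ts) (i # p) \<longleftrightarrow> i < length ts \<and> interior_vertex (ts ! i) p"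
  by (auto simp: interior_vertex_def children_Cons Cons_in_vertices simp del: vertices.simps)

lemma interior_vertex_Nil: "interior_vertex T [] \<longleftrightarrow> T \<noteq> Node []"
  by (cases T) (auto simp: interior_vertex_def children_Nil Nil_in_vertices simp del: vertices.simps)

lemma old_leaf_Nil: "\<not> old_leaf T []"
  by (simp add: old_leaf_def)

text \<open>The extra disjunct is the only change that hanging subtrees under a new root causes: a
  one-vertex subtree has its root as a young leaf, and that root turns old when the subtree is the
  leftmost one.\<close>

lemma old_leaf_Cons:
  "old_leaf (Node ts) (i # p) \<longleftrightarrow>
     i < length ts \<and> (old_leaf (ts ! i) p \<or> p = [] \<and> i = 0 \<and> ts ! 0 = Node [])"
  by (cases p) (auto simp: old_leaf_def leaf_Cons leaf_Nil Cons_eq_append_conv)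

lemma young_leaf_Nil: "young_leaf T [] \<longleftrightarrow> T = Node []"
  by (simp add: young_leaf_def old_leaf_Nil leaf_Nil)

lemma young_leaf_Cons:
  "young_leaf (Node ts) (i # p) \<longleftrightarrow>
     i < length ts \<and> young_leaf (ts ! i) p \<and> \<not> (p = [] \<and> i = 0 \<and> ts ! 0 = Node [])"
  by (auto simp: young_leaf_def old_leaf_Cons leaf_Cons)

lemma old_interior_vertex_Nil:
  "old_interior_vertex (Node ts) [] \<longleftrightarrow> ts \<noteq> [] \<and> ts ! 0 = Node []"
  by (auto simp: old_interior_vertex_def interior_vertex_Nil children_Nil old_leaf_Cons
      old_leaf_Nil)

text \<open>No correction as in \<open>old_leaf_Cons\<close> arises, because the exceptional old
  leaf \<open>[0]\<close> is a child of the new root, never of a vertex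
  \<open>i # p\<close>.\<close>

lemma old_interior_vertex_Cons:
  "old_interior_vertex (Node ts) (i # p) \<longleftrightarrow> i < length ts \<and> old_interior_vertex (ts ! i) p"
  by (cases "i < length ts")
    (auto simp: old_interior_vertex_def interior_vertex_Cons children_Cons old_leaf_Cons
      in_children_iff)

lemma young_interior_vertex_Nil:
  "young_interior_vertex (Node ts) [] \<longleftrightarrow> ts \<noteq> [] \<and> ts ! 0 \<noteq> Node []"
  by (auto simp: young_interior_vertex_def old_interior_vertex_Nil interior_vertex_Nil)

lemma young_interior_vertex_Cons:
  "young_interior_vertex (Node ts) (i # p) \<longleftrightarrow>
     i < length ts \<and> young_interior_vertex (ts ! i) p"
  by (auto simp: young_interior_vertex_def old_interior_vertex_Cons interior_vertex_Cons)

lemmas vertex_predicate_simps =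
  old_leaf_Nil old_leaf_Cons young_leaf_Nil young_leaf_Cons
  old_interior_vertex_Nil old_interior_vertex_Cons
  young_interior_vertex_Nil young_interior_vertex_Cons

section \<open>Counting vertices of each kind\<close>

lemma finite_vertex_predicates:
  "finite {p. old_leaf T p}" "finite {p. young_leaf T p}"
  "finite {p. old_interior_vertex T p}" "finite {p. young_interior_vertex T p}"
  by (rule finite_subset[OF _ finite_vertices[of T]];
      auto simp: old_leaf_def young_leaf_def leaf_def old_interior_vertex_def
        young_interior_vertex_def interior_vertex_def)+

text \<open>Counts vertices after a subtree is attached as child number \<open>k\<close>:
  \<open>P\<close> describes the rest of the tree and \<open>Q\<close> the subtree, whose addresses
  get the prefix \<open>k\<close>.\<close>

lemma card_address_split:
  assumes fin: "finite {p. P p}" "finite {p. Q p}"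
    and Nil: "R [] \<longleftrightarrow> P []"
    and Cons: "\<And>i q. R (i # q) \<longleftrightarrow> P (i # q) \<or> i = k \<and> Q q"
    and disj: "\<And>q. \<not> P (k # q)"
  shows "card {p. R p} = card {p. P p} + card {p. Q p}"
proof -
  have "R p \<longleftrightarrow> P p \<or> p \<in> (#) k ` {p. Q p}" for p
    by (cases p) (auto simp: Nil Cons)
  then have "{p. R p} = {p. P p} \<union> (#) k ` {p. Q p}"
    by auto
  moreover have "{p. P p} \<inter> (#) k ` {p. Q p} = {}"
    using disj by auto
  ultimately show ?thesis
    using fin by (simp add: card_Un_disjoint card_image)
qed

text \<open>A child appended after others is not leftmost, so if it is a leaf it stays young. The
  kind of the root depends on the first child alone and does not change.\<close>

lemma stats_snoc:
  assumes "rs \<noteq> []"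
  shows "oleaf (Node (rs @ [S])) = oleaf (Node rs) + oleaf S"
    and "yleaf (Node (rs @ [S])) = yleaf (Node rs) + yleaf S"
    and "oint (Node (rs @ [S])) = oint (Node rs) + oint S"
    and "yint (Node (rs @ [S])) = yint (Node rs) + yint S"
  unfolding oleaf_def yleaf_def oint_def yint_def
  by (rule card_address_split[where k = "length rs"];
      use assms in \<open>auto simp: finite_vertex_predicates vertex_predicate_simps nth_append
        less_Suc_eq\<close>)+

text \<open>The only child of the new root is not a leaf, so the new root is a young interior vertex
  and every vertex of \<open>S\<close> keeps its kind.\<close>

lemma stats_single:
  assumes "S \<noteq> Node []"
  shows "oleaf (Node [S]) = oleaf S" "yleaf (Node [S]) = yleaf S"
    "oint (Node [S]) = oint S" "yint (Node [S]) = Suc (yint S)"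
proof -
  have eq: "card {p. R p} = card {p. Q p}"
    if "finite {p. Q p}" "\<not> R []" "\<And>i q. R (i # q) \<longleftrightarrow> i = 0 \<and> Q q"
    for R Q :: "nat list \<Rightarrow> bool"
    using card_address_split[of "\<lambda>_. False" Q R 0] that by simp
  show "oleaf (Node [S]) = oleaf S" "yleaf (Node [S]) = yleaf S"
    "oint (Node [S]) = oint S"
    unfolding oleaf_def yleaf_def oint_def
    by (rule eq; use assms in \<open>auto simp: finite_vertex_predicates vertex_predicate_simps\<close>)+
  \<comment> \<open>The new root alone takes the place of the rest of the tree, and \<open>S\<close>
    hangs below it at index 0.\<close>
  have "card {p. young_interior_vertex (Node [S]) p} =
      card {p. p = ([] :: nat list)} + card {p. young_interior_vertex S p}"
    by (rule card_address_split[where k = 0])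
      (use assms in \<open>auto simp: finite_vertex_predicates vertex_predicate_simps\<close>)
  then show "yint (Node [S]) = Suc (yint S)"
    by (simp add: yint_def)
qed

text \<open>A lone root is a leaf without a parent, hence young. Its weight is therefore
  \<open>x2\<close>, unlike the conventional value \<open>y2\<close> of \<open>G 0\<close>.\<close>

lemma stats_leaf:
  "oleaf (Node []) = 0" "yleaf (Node []) = 1" "oint (Node []) = 0" "yint (Node []) = 0"
proof -
  have eq: "card {p. R p} = card {p. P p}"
    if "R [] = P []" "\<And>i q. R (i # q) = P (i # q)" for R P :: "nat list \<Rightarrow> bool"
  proof -
    have "R p = P p" for p
      using that by (cases p) simp_all
    then show ?thesis by simp
  qed
  have "card {p. old_leaf (Node []) p} = card {p :: nat list. False}"
    "card {p. young_leaf (Node []) p} = card {p. p = ([] :: nat list)}"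
    "card {p. old_interior_vertex (Node []) p} = card {p :: nat list. False}"
    "card {p. young_interior_vertex (Node []) p} = card {p :: nat list. False}"
    by (rule eq; simp add: vertex_predicate_simps)+
  then show "oleaf (Node []) = 0" "yleaf (Node []) = 1" "oint (Node []) = 0" "yint (Node []) = 0"
    by (simp_all add: oleaf_def yleaf_def oint_def yint_def)
qed

lemma stats_edge:
  "oleaf (Node [Node []]) = 1" "yleaf (Node [Node []]) = 0"
  "oint (Node [Node []]) = 1" "yint (Node [Node []]) = 0"
proof -
  have eq: "card {p. R p} = card {p. P p}"
    if "R [] = P []" "\<And>i. R [i] = P [i]" "\<And>i j q. R (i # j # q) = P (i # j # q)"
    for R P :: "nat list \<Rightarrow> bool"
  proof -
    have "R p = P p" for p
      using that by (metis list.exhaust)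
    then show ?thesis by simp
  qed
  have "card {p. old_leaf (Node [Node []]) p} = card {p. p = [0 :: nat]}"
    "card {p. young_leaf (Node [Node []]) p} = card {p :: nat list. False}"
    "card {p. old_interior_vertex (Node [Node []]) p} = card {p. p = ([] :: nat list)}"
    "card {p. young_interior_vertex (Node [Node []]) p} = card {p :: nat list. False}"
    by (rule eq; auto simp: vertex_predicate_simps)+
  then show "oleaf (Node [Node []]) = 1" "yleaf (Node [Node []]) = 0"
    "oint (Node [Node []]) = 1" "yint (Node [Node []]) = 0"
    by (simp_all add: oleaf_def yleaf_def oint_def yint_def)
qed

section \<open>Decomposition of plane trees by the last child of the root\<close>

lemma card_edges_snoc:
  "card (edges (Node (rs @ [S]))) = Suc (card (edges (Node rs)) + card (edges S))"
proof -
  have "card {p. p \<in> vertices (Node (rs @ [S]))} =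
      card {p. p \<in> vertices (Node rs)} + card {p. p \<in> vertices S}"
    by (rule card_address_split[where k = "length rs"])
      (auto simp: finite_vertices Cons_in_vertices Nil_in_vertices nth_append less_Suc_eq
        simp del: vertices.simps)
  then show ?thesis
    by (simp flip: card_edges del: vertices.simps)
qed

lemma card_edges_Node_Nil: "card (edges (Node [])) = 0"
  using card_edges[of "Node []"] by simp

lemma plane_trees_0: "plane_trees 0 = {Node []}"
proof -
  have "T = Node []" if "card (edges T) = 0" for T
  proof (cases T)
    case (Node ts)
    then show ?thesis
      using that by (cases ts rule: rev_cases) (auto simp: card_edges_snoc)
  qed
  then show ?thesis
    by (auto simp: plane_trees_def card_edges_Node_Nil)
qed

text \<open>The two trees form one argument so that sums over products of tree sets can be reindexed
  along this injection.\<close>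

fun add_last_child :: "plane_tree \<times> plane_tree \<Rightarrow> plane_tree" where
  "add_last_child (Node rs, S) = Node (rs @ [S])"

lemma inj_add_last_child: "inj add_last_child"
  by (rule injI) (auto elim!: add_last_child.elims)

lemma card_edges_add_last_child:
  "card (edges (add_last_child (T, S))) = Suc (card (edges T) + card (edges S))"
  by (cases T) (simp add: card_edges_snoc)

text \<open>Cutting off the last principal subtree \<open>S\<close> removes the edge above it, so
  the remaining \<open>n\<close> edges are shared between \<open>S\<close> and the rest of the
  tree.\<close>

lemma plane_trees_Suc:
  "plane_trees (Suc n) =
     add_last_child ` (\<Union>i\<in>{..n}. plane_trees i \<times> plane_trees (n - i))"
proof (intro equalityI subsetI)
  fix T assume T: "T \<in> plane_trees (Suc n)"
  obtain ts where ts: "T = Node ts" by (cases T)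
  have "ts \<noteq> []"
    using T by (auto simp: ts plane_trees_def card_edges_Node_Nil)
  then obtain rs S where rs: "ts = rs @ [S]"
    by (metis rev_exhaust)
  have "(Node rs, S) \<in> (\<Union>i\<in>{..n}. plane_trees i \<times> plane_trees (n - i))"
    using T by (auto simp: ts rs plane_trees_def card_edges_snoc)
  moreover have "T = add_last_child (Node rs, S)"
    by (simp add: ts rs)
  ultimately show "T \<in> add_last_child ` (\<Union>i\<in>{..n}. plane_trees i \<times> plane_trees (n - i))"
    by blast
qed (auto simp: plane_trees_def card_edges_add_last_child)

lemma sum_plane_trees_Suc:
  "(\<Sum>T\<in>plane_trees (Suc n). f T) =
     (\<Sum>i\<le>n. \<Sum>T\<in>plane_trees i. \<Sum>S\<in>plane_trees (n - i). f (add_last_child (T, S)))"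
proof -
  let ?B = "\<lambda>i. plane_trees i \<times> plane_trees (n - i)"
  have disj: "?B i \<inter> ?B j = {}" if "i \<noteq> j" for i j
    using that by (auto simp: plane_trees_def)
  have "(\<Sum>T\<in>plane_trees (Suc n). f T) = (\<Sum>p\<in>(\<Union>i\<in>{..n}. ?B i). f (add_last_child p))"
    unfolding plane_trees_Suc
    by (rule sum.reindex_cong[OF inj_on_subset[OF inj_add_last_child]]) simp_all
  also have "\<dots> = (\<Sum>i\<le>n. \<Sum>p\<in>?B i. f (add_last_child p))"
    by (rule sum.UNION_disjoint) (simp_all add: finite_plane_trees disj)
  finally show ?thesis
    by (simp add: sum.cartesian_product')
qed

section \<open>A quadratic recurrence for the polynomials \<open>G\<close>\<close>

text \<open>Sort trees by the number \<open>i\<close> of edges left after cutting off the last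
  principal subtree. For \<open>i = 0\<close> the root has a single child that is not a leaf and
  contributes \<open>y2\<close>; for \<open>i = n\<close> the last child is a young leaf and
  contributes \<open>x2\<close>; in between the weights multiply. For \<open>n = 0\<close> both ends
  coincide in the one-edge tree of weight \<open>x1 * y1\<close>.\<close>

lemma G_Suc:
  fixes x1 x2 y1 y2 :: "'a :: comm_semiring_1"
  shows "G (Suc n) x1 x2 y1 y2 =
    (if n = 0 then x1 * y1
     else (x2 + y2) * G n x1 x2 y1 y2 +
       (\<Sum>i=1..<n. G i x1 x2 y1 y2 * G (n - i) x1 x2 y1 y2))"
proof -
  define wt where "wt T = x1 ^ oleaf T * x2 ^ yleaf T * y1 ^ oint T * y2 ^ yint T" for T
  have G: "G n x1 x2 y1 y2 = (\<Sum>T\<in>plane_trees n. wt T)" if "n > 0" for n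
    using that by (simp add: G_def wt_def)
  have wt_leaf: "wt (Node []) = x2"
    by (simp add: wt_def stats_leaf)
  have wt_snoc: "wt (add_last_child (T, S)) = wt T * wt S" if "T \<in> plane_trees i" "i > 0" for T S i
  proof (cases T)
    case (Node rs)
    then have "rs \<noteq> []"
      using that by (auto simp: plane_trees_def card_edges_Node_Nil)
    then show ?thesis
      by (simp add: Node wt_def stats_snoc power_add mult_ac)
  qed
  have wt_single: "wt (Node [S]) = y2 * wt S" if "S \<in> plane_trees n" "n > 0" for S n
  proof -
    have "S \<noteq> Node []"
      using that by (auto simp: plane_trees_def card_edges_Node_Nil)
    then show ?thesis
      by (simp add: wt_def stats_single mult_ac)
  qed
  have wt_edge: "wt (Node [Node []]) = x1 * y1"
    by (simp add: wt_def stats_edge)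
  show ?thesis
  proof (cases "n = 0")
    case True
    then show ?thesis
      by (simp add: G sum_plane_trees_Suc plane_trees_0 wt_edge)
  next
    case False
    have "G (Suc n) x1 x2 y1 y2 =
        (\<Sum>i\<le>n. \<Sum>T\<in>plane_trees i. \<Sum>S\<in>plane_trees (n - i). wt (add_last_child (T, S)))"
      by (simp add: G sum_plane_trees_Suc)
    \<comment> \<open>The two ends are separated because the one-vertex tree does not have the
      weight \<open>G 0\<close>.\<close>
    also have "{..n} = insert 0 (insert n {1..<n})"
      using False by auto
    also have "(\<Sum>i\<in>insert 0 (insert n {1..<n}). \<Sum>T\<in>plane_trees i.
        \<Sum>S\<in>plane_trees (n - i). wt (add_last_child (T, S))) =
        (\<Sum>S\<in>plane_trees n. wt (Node [S])) +
        ((\<Sum>T\<in>plane_trees n. wt (add_last_child (T, Node []))) +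
        (\<Sum>i=1..<n. \<Sum>T\<in>plane_trees i. \<Sum>S\<in>plane_trees (n - i). wt (add_last_child (T, S))))"
      using False by (simp add: plane_trees_0)
    also have "(\<Sum>S\<in>plane_trees n. wt (Node [S])) = y2 * G n x1 x2 y1 y2"
      using False by (simp add: G wt_single sum_distrib_left)
    also have "(\<Sum>T\<in>plane_trees n. wt (add_last_child (T, Node []))) = x2 * G n x1 x2 y1 y2"
      using False by (simp add: G wt_snoc wt_leaf sum_distrib_left mult_ac)
    also have "(\<Sum>i=1..<n. \<Sum>T\<in>plane_trees i. \<Sum>S\<in>plane_trees (n - i).
        wt (add_last_child (T, S))) =
        (\<Sum>i=1..<n. G i x1 x2 y1 y2 * G (n - i) x1 x2 y1 y2)"
      by (intro sum.cong refl) (simp add: G wt_snoc sum_product)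
    finally show ?thesis
      using False by (simp add: algebra_simps)
  qed
qed

text \<open>The recurrence \<open>G_Suc\<close> sees \<open>x1\<close> and \<open>y1\<close> only
  through their product. This is what allows the grammar to treat that product as one
  variable.\<close>

lemma G_product_weight:
  fixes x1 x2 y1 y2 :: "'a :: comm_semiring_1"
  shows "G n x1 x2 y1 y2 = G n (x1 * y1) x2 1 y2"
proof (induction n rule: less_induct)
  case (less n)
  show ?case
  proof (cases n)
    case (Suc m)
    show ?thesis
      unfolding Suc G_Suc using less by (auto simp: Suc intro!: arg_cong2[of _ _ _ _ "(+)"] sum.cong)
  qed (simp add: G_def)
qed

section \<open>Derivations\<close>

text \<open>Each coefficient of \<open>fps_X * A * E\<close> involves only earlier coefficients of
  \<open>E\<close>. Hence \<open>1 - fps_X * A\<close> can be cancelled over any commutative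
  ring.\<close>

lemma fps_linear_fixpoint_eq_0:
  fixes E A :: "'a :: comm_ring_1 fps"
  assumes "E = fps_X * A * E"
  shows "E = 0"
proof (rule fps_ext)
  fix n
  show "fps_nth E n = fps_nth 0 n"
  proof (induction n rule: less_induct)
    case (less n)
    have "fps_nth E n = fps_nth (fps_X * (A * E)) n"
      using assms by (simp add: mult.assoc)
    also have "\<dots> = (if n = 0 then 0 else fps_nth (A * E) (n - 1))"
      by simp
    also have "\<dots> = 0"
      using less by (simp add: fps_mult_nth)
    finally show ?case by simp
  qed
qed

text \<open>The quadratic equation for the generating function determines both of its derivatives.
  The subtracted term has the form that the product rule applied to \<open>t ^ n\<close> compensates
  later.\<close>

lemma derivation_G:
  fixes D :: "'a :: comm_ring_1 \<Rightarrow> 'a"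
  assumes add: "\<And>a b. D (a + b) = D a + D b" and mult: "\<And>a b. D (a * b) = D a * b + a * D b"
    and w: "D w = 2 * t * w * (x2 + y2)" and x2: "D x2 = 2 * t * w" and y2: "D y2 = 2 * t * w"
    and "n > 0"
  shows "D (G n w x2 1 y2) =
    t * (of_nat (n + 2) * G (Suc n) w x2 1 y2 - of_nat n * (x2 + y2) * G n w x2 1 y2)"
proof -
  \<comment> \<open>\<open>L\<close> extends \<open>D\<close> to a derivation of power series that
    treats \<open>fps_X\<close> as a constant.\<close>
  define L where "L F = Abs_fps (\<lambda>n. D (fps_nth F n))" for F :: "'a fps"
  have D0: "D 0 = 0"
    using add[of 0 0] by simp
  have D_sum: "D (sum f A) = (\<Sum>x\<in>A. D (f x))" for f :: "nat \<Rightarrow> 'a" and A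
    by (induction A rule: infinite_finite_induct) (simp_all add: D0 add)
  have L_add: "L (F + H) = L F + L H" for F H
    by (rule fps_ext) (simp add: L_def add)
  have L_mult: "L (F * H) = L F * H + F * L H" for F H
    by (rule fps_ext) (simp add: L_def fps_mult_nth D_sum mult sum.distrib)
  have L_X: "L (fps_X * F) = fps_X * L F" for F
    by (rule fps_ext) (simp add: L_def D0)
  have L_const: "L (fps_const c) = fps_const (D c)" for c
    by (rule fps_ext) (simp add: L_def D0)

  \<comment> \<open>The constant coefficient is 0 instead of \<open>G 0\<close>: then
    \<open>P * P\<close> is exactly the convolution in \<open>G_Suc\<close>, where both end terms
    are absent.\<close>
  define P where "P = Abs_fps (\<lambda>n. if n = 0 then 0 else G n w x2 1 y2)"
  define W where "W = fps_const w"
  define U where "U = fps_const (x2 + y2)"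
  define T where "T = fps_const t"
  define A where "A = W + U * P + P * P"
  have P_X: "P = fps_X * A"
  proof (rule fps_ext)
    fix n
    show "fps_nth P n = fps_nth (fps_X * A) n"
    proof (cases n)
      case (Suc m)
      have "fps_nth (P * P) m = (\<Sum>i=0..m. fps_nth P i * fps_nth P (m - i))"
        by (simp add: fps_mult_nth)
      also have "\<dots> = (\<Sum>i=1..<m. fps_nth P i * fps_nth P (m - i))"
        by (rule sum.mono_neutral_right) (auto simp: P_def)
      also have "\<dots> = (\<Sum>i=1..<m. G i w x2 1 y2 * G (m - i) w x2 1 y2)"
        by (intro sum.cong) (auto simp: P_def)
      finally have "fps_nth (P * P) m = \<dots>" .
      then show ?thesis
        by (simp add: Suc A_def W_def U_def) (simp add: P_def G_Suc)
    qed (simp add: P_def)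
  qed
  have L_W: "L W = 2 * T * W * U"
    by (simp add: W_def T_def U_def L_const w numeral_fps_const flip: fps_const_mult)
  have L_U: "L U = 4 * T * W"
    by (simp add: W_def T_def U_def L_const add x2 y2 numeral_fps_const mult.assoc)
  \<comment> \<open>The defect of the claim, read as an identity of power series. Subtracting
    \<open>2 * W\<close> affects only the constant coefficient: there \<open>fps_deriv P\<close> and
    \<open>A\<close> contribute \<open>w\<close> each, while \<open>L P\<close> has 0.\<close>
  define E where "E = L P - T * ((1 - fps_X * U) * fps_deriv P + A - 2 * W)"
  have LP: "L P = fps_X * (2 * T * W * U + 4 * T * W * P + U * L P + 2 * P * L P)"
  proof -
    have "L P = fps_X * L A"
      using P_X L_X by metis
    also have "L A = 2 * T * W * U + 4 * T * W * P + U * L P + 2 * P * L P"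
      by (simp add: A_def L_add L_mult L_W L_U algebra_simps)
    finally show ?thesis .
  qed
  have P': "fps_deriv P = A + fps_X * (U * fps_deriv P + 2 * P * fps_deriv P)"
  proof -
    have "fps_deriv P = A + fps_X * fps_deriv A"
      by (subst P_X) simp
    also have "fps_deriv A = U * fps_deriv P + 2 * P * fps_deriv P"
      by (simp add: A_def W_def U_def algebra_simps)
    finally show ?thesis .
  qed
  \<comment> \<open>Collecting the terms with \<open>L P\<close> in \<open>LP\<close>, or with
    \<open>fps_deriv P\<close> in \<open>P'\<close>, leaves this common factor: the partial
    derivative of \<open>P - fps_X * A\<close> with respect to \<open>P\<close>.\<close>
  define K where "K = 1 - fps_X * U - 2 * fps_X * P"
  have LP_K: "L P * K = T * (fps_X * (2 * W * U + 4 * W * P))"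
  proof -
    have "L P * K = L P - fps_X * (U * L P + 2 * P * L P)"
      by (simp add: K_def algebra_simps)
    also have "\<dots> = fps_X * (2 * T * W * U + 4 * T * W * P)"
      unfolding diff_eq_eq by (rule trans[OF LP]) (simp add: algebra_simps)
    finally show ?thesis
      by (simp add: algebra_simps)
  qed
  have P'_K: "fps_deriv P * K = A"
  proof -
    have "fps_deriv P * K = fps_deriv P - fps_X * (U * fps_deriv P + 2 * P * fps_deriv P)"
      by (simp add: K_def algebra_simps)
    also have "\<dots> = A"
      unfolding diff_eq_eq by (rule P')
    finally show ?thesis .
  qed
  have A_K: "A * K = A - U * (fps_X * A) - 2 * P * (fps_X * A)"
    by (simp add: K_def algebra_simps)
  have "((1 - fps_X * U) * fps_deriv P + A - 2 * W) * K =
      (1 - fps_X * U) * (fps_deriv P * K) + A * K - 2 * W * K"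
    by (simp add: algebra_simps)
  also have "\<dots> = 2 * A - 2 * (U + P) * (fps_X * A) - 2 * W * K"
    unfolding P'_K A_K by (simp add: algebra_simps)
  \<comment> \<open>With \<open>fps_X * A = P\<close> the first two terms collapse to
    \<open>2 * W\<close>, and \<open>1 - K\<close> supplies the factor \<open>fps_X\<close>. The
    result is the right-hand side of \<open>LP_K\<close> without \<open>T\<close>.\<close>
  also have "\<dots> = fps_X * (2 * W * U + 4 * W * P)"
    unfolding P_X[symmetric] by (simp add: K_def A_def algebra_simps)
  finally have "E * K = 0"
    by (simp add: E_def left_diff_distrib mult.assoc LP_K)
  \<comment> \<open>Since \<open>K = 1 - fps_X * (U + 2 * P)\<close>, vanishing of
    \<open>E * K\<close> makes \<open>E\<close> a fixed point to which
    \<open>fps_linear_fixpoint_eq_0\<close> applies.\<close>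
  moreover have "E - fps_X * (U + 2 * P) * E = E * K"
    by (simp add: K_def algebra_simps)
  ultimately have "E - fps_X * (U + 2 * P) * E = 0"
    by (simp only:)
  then have "E = fps_X * (U + 2 * P) * E"
    by (simp only: eq_iff_diff_eq_0[of E])
  then have "E = 0"
    by (rule fps_linear_fixpoint_eq_0)
  then have LP_eq: "L P = T * ((1 - fps_X * U) * fps_deriv P + A - 2 * W)"
    by (simp add: E_def)
  have A_nth: "fps_nth A n = G (Suc n) w x2 1 y2"
    using arg_cong[OF P_X, of "\<lambda>F. fps_nth F (Suc n)"] by (simp add: P_def)
  obtain m where m: "n = Suc m"
    using \<open>n > 0\<close> gr0_conv_Suc by auto
  have XUP': "fps_nth (fps_X * U * fps_deriv P) n = (x2 + y2) * (of_nat n * G n w x2 1 y2)"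
    by (simp add: m U_def P_def mult.assoc)
  have W_nth: "fps_nth (2 * W) n = 0"
    by (simp add: m W_def numeral_fps_const)
  have P'_nth: "fps_nth (fps_deriv P) n = of_nat (n + 1) * G (Suc n) w x2 1 y2"
    by (simp add: P_def)
  have "D (G n w x2 1 y2) = fps_nth (L P) n"
    using \<open>n > 0\<close> by (simp add: L_def P_def)
  also have "\<dots> = t * (fps_nth (fps_deriv P) n -
      fps_nth (fps_X * U * fps_deriv P) n + fps_nth A n - fps_nth (2 * W) n)"
    unfolding LP_eq T_def fps_mult_left_const_nth left_diff_distrib fps_sub_nth fps_add_nth
    by (simp only: mult_1_left)
  also have "\<dots> = t * (of_nat (n + 2) * G (Suc n) w x2 1 y2 -
      of_nat n * (x2 + y2) * G n w x2 1 y2)"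
    unfolding XUP' W_nth P'_nth A_nth by (simp add: algebra_simps)
  finally show ?thesis .
qed

section \<open>Iterating the grammar derivation\<close>

lemma derivation_of_nat:
  assumes "is_formal_derivative f D"
  shows "D (of_nat k) = 0"
proof -
  have *: "D (Const c) = 0" "D (p + q) = D p + D q" for c p q
    using assms by (simp_all add: is_formal_derivative_def)
  have "D 0 = 0" "D 1 = 0"
    using *(1)[of 0] *(1)[of 1] by (simp_all add: Const_def)
  then show ?thesis
    by (induction k) (simp_all add: *)
qed

lemma derivation_power:
  assumes "is_formal_derivative f D"
  shows "D (p ^ Suc k) = of_nat (Suc k) * p ^ k * D p"
proof (induction k)
  case (Suc k)
  have "D (p ^ Suc (Suc k)) = D p * p ^ Suc k + p * D (p ^ Suc k)"
    using assms unfolding power_Suc[of p "Suc k"] by (simp only: is_formal_derivative_def)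
  also have "\<dots> = of_nat (Suc (Suc k)) * p ^ Suc k * D p"
    unfolding Suc by (simp add: algebra_simps)
  finally show ?case .
qed simp

lemma formal_derivative_iterate:
  "(formal_derivative grammar ^^ n) (Var GY2) =
     fact (n + 1) * Var GT ^ n * G n (Var GW) (Var GX2) 1 (Var GY2)"
proof (induction n)
  case 0
  then show ?case by (simp add: G_def)
next
  case (Suc n)
  define D where "D = formal_derivative grammar"
  define g where "g n = G n (Var GW) (Var GX2) 1 (Var GY2)" for n
  define u where "u = Var GX2 + Var GY2"
  have D: "is_formal_derivative grammar D"
    by (simp add: D_def is_formal_derivative_formal_derivative)
  then have D_simps: "D (Var z) = grammar z" "D (a * b) = D a * b + a * D b"
    "D (a + b) = D a + D b" for z a b
    by (simp_all add: is_formal_derivative_def)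
  show ?case
  proof (cases n)
    \<comment> \<open>\<open>derivation_G\<close> needs a positive index; here directly D(y2) = 2tw
      = 2! t G_1.\<close>
    case 0
    then show ?thesis
      by (simp add: G_Suc D_simps flip: D_def)
  next
    case (Suc m)
    have Dg: "D (g n) = Var GT * (of_nat (n + 2) * g (Suc n) - of_nat n * u * g n)"
      unfolding g_def u_def by (rule derivation_G) (simp_all add: D_simps Suc)
    have "D (Var GT ^ n) = of_nat n * Var GT ^ Suc n * u"
      unfolding Suc derivation_power[OF D]
      by (simp add: D_simps u_def power2_eq_square algebra_simps)
    \<comment> \<open>D(t^n) = n t^(n+1) u, so the product rule cancels the term with
      \<open>g n\<close> in \<open>Dg\<close>. The surviving factor \<open>n + 2\<close> extends the
      factorial.\<close>
    then have Dtg: "D (Var GT ^ n * g n) = of_nat (n + 2) * Var GT ^ Suc n * g (Suc n)"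
      unfolding D_simps(2) Dg by (simp add: algebra_simps)
    have D_fact: "D (fact (n + 1)) = 0"
      using derivation_of_nat[OF D, of "fact (n + 1)"] by (simp only: of_nat_fact)
    have fact_Suc': "fact (Suc n + 1) = (of_nat (n + 2) * fact (n + 1) :: grammar_var qpoly)"
      using fact_Suc[of "n + 1"] by simp
    have "(D ^^ Suc n) (Var GY2) = D (fact (n + 1) * (Var GT ^ n * g n))"
      using Suc.IH by (simp only: funpow.simps o_apply g_def D_def mult.assoc)
    also have "\<dots> = fact (n + 1) * D (Var GT ^ n * g n)"
      by (simp only: D_simps(2)[of "fact (n + 1)"] D_fact mult_zero_left add_0_left)
    also have "\<dots> = fact (Suc n + 1) * Var GT ^ Suc n * g (Suc n)"
      unfolding Dtg fact_Suc' by (simp only: mult_ac)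
    finally show ?thesis
      by (simp only: D_def g_def)
  qed
qed

section \<open>Substitution is a ring homomorphism\<close>

lemma monom_subst_superset:
  assumes "finite A" "Poly_Mapping.keys m \<subseteq> A"
  shows "(\<Prod>v\<in>Poly_Mapping.keys m. \<sigma> v ^ Poly_Mapping.lookup m v) =
    (\<Prod>v\<in>A. \<sigma> v ^ Poly_Mapping.lookup m v :: 'b :: comm_semiring_1)"
  using assms by (intro prod.mono_neutral_left) (auto simp: in_keys_iff)

text \<open>Over the union of both supports a variable missing from one monomial has exponent 0 and
  contributes 1, so all products can be compared factor by factor.\<close>

lemma monom_subst_add:
  "(\<Prod>v\<in>Poly_Mapping.keys (m + m'). \<sigma> v ^ Poly_Mapping.lookup (m + m') v) =
     (\<Prod>v\<in>Poly_Mapping.keys m. \<sigma> v ^ Poly_Mapping.lookup m v) *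
     (\<Prod>v\<in>Poly_Mapping.keys m'. \<sigma> v ^ Poly_Mapping.lookup m' v :: 'b :: comm_semiring_1)"
proof -
  let ?A = "Poly_Mapping.keys m \<union> Poly_Mapping.keys m'"
  have "Poly_Mapping.keys (m + m') \<subseteq> ?A"
    by (rule keys_add)
  then have "(\<Prod>v\<in>Poly_Mapping.keys (m + m'). \<sigma> v ^ Poly_Mapping.lookup (m + m') v) =
      (\<Prod>v\<in>?A. \<sigma> v ^ Poly_Mapping.lookup (m + m') v)"
    by (intro monom_subst_superset) simp_all
  also have "\<dots> = (\<Prod>v\<in>?A. \<sigma> v ^ Poly_Mapping.lookup m v) *
      (\<Prod>v\<in>?A. \<sigma> v ^ Poly_Mapping.lookup m' v)"
    by (simp add: lookup_add power_add prod.distrib)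
  finally show ?thesis
    by (simp only: monom_subst_superset[of ?A m] monom_subst_superset[of ?A m']
        finite_UnI finite_keys Un_upper1 Un_upper2)
qed

lemma poly_subst_add: "poly_subst \<sigma> (p + q) = poly_subst \<sigma> p + poly_subst \<sigma> q"
  unfolding poly_subst_def
  by (rule setsum_keys_plus_distrib) (simp_all add: Const_add algebra_simps, simp add: Const_def)

lemma poly_subst_single:
  "poly_subst \<sigma> (Poly_Mapping.single m c) =
     Const c * (\<Prod>v\<in>Poly_Mapping.keys m. \<sigma> v ^ Poly_Mapping.lookup m v)"
  by (simp add: poly_subst_def Const_def)

lemma Const_mult: "Const (c * d) = Const c * Const d"
  by (simp add: Const_def mult_single)

text \<open>Additivity in each factor reduces the claim to two monomials, where exponents
  add.\<close>

lemma poly_subst_mult: "poly_subst \<sigma> (p * q) = poly_subst \<sigma> p * poly_subst \<sigma> q"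
proof (induction p rule: poly_induct_single)
  case zero
  then show ?case by (simp add: poly_subst_def)
next
  case (add p m c)
  have "poly_subst \<sigma> (Poly_Mapping.single m c * q) =
      poly_subst \<sigma> (Poly_Mapping.single m c) * poly_subst \<sigma> q"
  proof (induction q rule: poly_induct_single)
    case zero
    then show ?case by (simp add: poly_subst_def)
  next
    case (add q n d)
    have "poly_subst \<sigma> (Poly_Mapping.single m c * Poly_Mapping.single n d) =
        poly_subst \<sigma> (Poly_Mapping.single m c) * poly_subst \<sigma> (Poly_Mapping.single n d)"
      unfolding mult_single poly_subst_single monom_subst_add Const_mult by (simp only: mult_ac)
    then show ?case using add by (simp add: algebra_simps poly_subst_add)
  qed
  then show ?case using add by (simp add: algebra_simps poly_subst_add)
qed

lemma poly_subst_Var: "poly_subst \<sigma> (Var v) = \<sigma> v"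
  by (simp add: Var_def poly_subst_single) (simp add: Const_def)

lemma poly_subst_0: "poly_subst \<sigma> 0 = 0"
  by (simp add: poly_subst_def)

lemma poly_subst_1: "poly_subst \<sigma> 1 = 1"
  using poly_subst_single[of \<sigma> 0 1] by (simp add: Const_def)

lemma poly_subst_of_nat: "poly_subst \<sigma> (of_nat k) = of_nat k"
  by (induction k) (simp_all add: poly_subst_0 poly_subst_1 poly_subst_add)

lemma poly_subst_power: "poly_subst \<sigma> (p ^ k) = poly_subst \<sigma> p ^ k"
  by (induction k) (simp_all add: poly_subst_1 poly_subst_mult)

lemma poly_subst_sum: "poly_subst \<sigma> (sum f A) = (\<Sum>x\<in>A. poly_subst \<sigma> (f x))"
  by (induction A rule: infinite_finite_induct) (simp_all add: poly_subst_0 poly_subst_add)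

lemma poly_subst_G:
  "poly_subst \<sigma> (G n x1 x2 y1 y2) =
     G n (poly_subst \<sigma> x1) (poly_subst \<sigma> x2) (poly_subst \<sigma> y1) (poly_subst \<sigma> y2)"
  by (simp add: G_def poly_subst_sum poly_subst_mult poly_subst_power)

theorem theorem1p21:
  fixes n :: nat
  shows "poly_subst w_subst ((formal_derivative grammar ^^ n) (Var GY2)) =
    fact (n + 1) * Var FT ^ n * G n (Var FX1) (Var FX2) (Var FY1) (Var FY2)"
proof -
  have "poly_subst w_subst (fact (n + 1)) = fact (n + 1)"
    using poly_subst_of_nat[of w_subst "fact (n + 1)"] by (simp only: of_nat_fact)
  \<comment> \<open>\<open>w_subst\<close> turns the weight \<open>Var GW\<close> into
    \<open>Var FX1 * Var FY1\<close> and leaves 1 fixed, so \<open>G_product_weight\<close>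
    identifies both sides.\<close>
  then show ?thesis
    unfolding formal_derivative_iterate poly_subst_mult
    by (simp add: poly_subst_power poly_subst_G poly_subst_Var poly_subst_1
        G_product_weight[of n "Var FX1"])
qed

end
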